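(* Let $p\in[1,+\infty)$ and let $m$ and $n$ be positive integers. Suppose that a sequence $\{u_i\}_{i=1}^{+\infty}$ converges weakly in $(L_\mu^p({\bf R}^n))^m$ to $u$ as $i$ goes to infinity. Assume that all the values of $u$ and $u_i$ ($i=1,2,3,\dots$) belong to a convex set $K$ in ${\bf R}^m$ and that $f(w)$ is a nonnegative continuous convex function from $K$ to ${\bf R}$. Then $$\liminf_{i\to+\infty}\int_{\Omega}f(u_i)\,d\mu\geq\int_{\Omega}f(u)\,d\mu$$ for any measurable set $\Omega\subseteq{\bf R}^n$.
   Context: $\mu$ is the (nonnegative) Lebesgue measure on ${\bf R}^n$. For $p\in[1,+\infty)$, $L_\mu^p({\bf R}^n)$ is the Banach space of real-valued measurable functions $\hat u$ on ${\bf R}^n$ with finite norm $\|\hat u\|_p=\left(\int_{{\bf R}^n}|\hat u(x)|^p\,d\mu\right)^{1/p}$. $(L_\mu^p({\bf R}^n))^m$ is the Banach space of vector-valued functions $u=(\hat u^{(1)},\dots,\hat u^{(m)})$ with all components in $L_\mu^p({\bf R}^n)$, with norm $\|u\|_p=\left(\sum_{j=1}^m\|\hat u^{(j)}\|_p^p\right)^{1/p}$. Let $q=p/(p-1)$ if $p\in(1,+\infty)$ and $q=\infty$ if $p=1$. A sequence $\{\hat u_i\}$ in $L_\mu^p({\bf R}^n)$ converges weakly to $\hat u\in L_\mu^p({\bf R}^n)$ if $\lim_{i\to\infty}\int_{{\bf R}^n}\hat u_i\hat v\,d\mu=\int_{{\bf R}^n}\hat u\hat v\,d\mu$ for all $\hat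 v\in L_\mu^q({\bf R}^n)$. A sequence $u_i=(\hat u_i^{(1)},\dots,\hat u_i^{(m)})$ converges weakly in $(L_\mu^p({\bf R}^n))^m$ to $u=(\hat u^{(1)},\dots,\hat u^{(m)})$ if, for each $j=1,\dots,m$, $\hat u_i^{(j)}$ converges weakly in $L_\mu^p({\bf R}^n)$ to $\hat u^{(j)}$ as $i\to\infty$. Integrals of nonnegative functions may take the value $+\infty$. *)

theory Defs
  imports "HOL-Analysis.Analysis"
begin

text \<open>Functions are not identified almost everywhere: the two spaces below are the sets of
  representatives, so pointwise values such as \<open>u x \<in> K\<close> make sense.\<close>

definition Lp_space :: "real \<Rightarrow> 'a measure \<Rightarrow> ('a \<Rightarrow> real) set" where
  "Lp_space p M = {g \<in> borel_measurable M. (\<integral>\<^sup>+x. ennreal (\<bar>g x\<bar> powr p) \<partial>M) < \<infinity>}"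

definition Linf_space :: "'a measure \<Rightarrow> ('a \<Rightarrow> real) set" where
  "Linf_space M = {g \<in> borel_measurable M. \<exists>C. AE x in M. \<bar>g x\<bar> \<le> C}"

definition Lp_dual_space :: "real \<Rightarrow> 'a measure \<Rightarrow> ('a \<Rightarrow> real) set" where
  "Lp_dual_space p M = (if p = 1 then Linf_space M else Lp_space (p / (p - 1)) M)"

text \<open>The Bochner integrals below are never the default value 0 of a non-integrable function:
  for \<open>p \<ge> 1\<close> the products are integrable by Hoelder's inequality.\<close>

definition weakly_converges_Lp ::
    "real \<Rightarrow> 'a measure \<Rightarrow> (nat \<Rightarrow> 'a \<Rightarrow> real) \<Rightarrow> ('a \<Rightarrow> real) \<Rightarrow> bool" where
  "weakly_converges_Lp p M g h \<longleftrightarrow>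
     (\<forall>i. g i \<in> Lp_space p M) \<and> h \<in> Lp_space p M \<and>
     (\<forall>v \<in> Lp_dual_space p M.
        (\<lambda>i. \<integral>x. g i x * v x \<partial>M) \<longlonglongrightarrow> (\<integral>x. h x * v x \<partial>M))"

definition weakly_converges_Lp_vec ::
    "real \<Rightarrow> 'a measure \<Rightarrow> (nat \<Rightarrow> 'a \<Rightarrow> real ^ 'm) \<Rightarrow> ('a \<Rightarrow> real ^ 'm) \<Rightarrow> bool" where
  "weakly_converges_Lp_vec p M g h \<longleftrightarrow>
     (\<forall>j. weakly_converges_Lp p M (\<lambda>i x. g i x $ j) (\<lambda>x. h x $ j))"

end

theory Submission
  imports Defs
begin

text \<open>For affine \<open>l\<close>, a set \<open>P\<close> of finite measure and \<open>u\<^sub>i\<close> converging weakly to \<open>u\<close>, the integral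
  of \<open>l \<circ> u\<^sub>i\<close> over \<open>P\<close> converges to that of \<open>l \<circ> u\<close>: the indicator of \<open>P\<close> is an admissible test
  function. So the theorem comes down to replacing \<open>f\<close> by affine functions below it.

  A continuous convex \<open>f\<close> on \<open>K\<close> is the supremum of its affine minorants, by separating points below
  the graph from the closure of the epigraph; a Lindelof argument makes the family countable
  (\<open>convex_eq_SUP_affine\<close>). Continuity relative to \<open>K\<close> suffices, so \<open>K\<close> may be any
  convex set, closed or not, with or without interior points.

  It remains to pass from the single minorants to their supremum. Put
  \<open>\<Phi>(E) = liminf \<integral>\<^sub>E f(u\<^sub>i)\<close>. As a lower limit of measures, \<open>\<Phi>\<close> is superadditive on disjoint sets.
  Each minorant satisfies \<open>\<integral>\<^sub>E l(u)\<^sup>+ \<le> \<Phi>(E)\<close> for \<^emph>\<open>every\<close> measurable \<open>E\<close>. The maximum of finitely many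
  such functions obeys the same bound: cut \<open>E\<close> into the pieces where each of them attains the
  maximum and add up. Monotone convergence extends the bound to the countable supremum
  (\<open>nn_integral_SUP_le_superadditive\<close>). The same lemma, applied to restrictions to the members of a
  countable cover, reduces a sigma-finite measure to sets of finite measure, where the Bochner
  integrals and the test functions make sense.\<close>

section \<open>Convex functions as suprema of affine functions\<close>

text \<open>Lower semicontinuity of \<open>f\<close> at \<open>w\<^sub>0\<close> keeps \<open>(w\<^sub>0, t)\<close> out of the closure of the epigraph, so a
  hyperplane separates the two strictly. Since \<open>w\<^sub>0\<close> itself lies in \<open>K\<close>, the vertical line through
  it meets the epigraph; hence the hyperplane is not vertical and is the graph of an affine function.\<close>

lemma affine_minorant_exceeding:
  fixes f :: "'a::euclidean_space \<Rightarrow> real"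
  assumes "convex_on K f" "continuous_on K f" "w\<^sub>0 \<in> K" "t < f w\<^sub>0"
  obtains a c where "\<And>w. w \<in> K \<Longrightarrow> a \<bullet> w + c \<le> f w" "t < a \<bullet> w\<^sub>0 + c"
proof -
  let ?S = "closure (epigraph K f)"
  have notin: "(w\<^sub>0, t) \<notin> ?S"
  proof
    assume in_cl: "(w\<^sub>0, t) \<in> ?S"
    define e where "e = (f w\<^sub>0 - t) / 2"
    have "e > 0" using assms by (simp add: e_def)
    obtain d where "d > 0" and d: "\<And>w. w \<in> K \<Longrightarrow> dist w w\<^sub>0 < d \<Longrightarrow> dist (f w) (f w\<^sub>0) < e"
      using assms \<open>e > 0\<close> unfolding continuous_on_iff by metis
    obtain z where z: "z \<in> epigraph K f" "dist z (w\<^sub>0, t) < min d e"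
      using in_cl \<open>d > 0\<close> \<open>e > 0\<close> unfolding closure_approachable by (metis min_less_iff_conj)
    obtain w s where zeq: "z = (w, s)" by (cases z)
    have "w \<in> K" "f w \<le> s" using z zeq by (auto simp: mem_epigraph)
    moreover have "dist w w\<^sub>0 < d" using z zeq dist_fst_le[of z "(w\<^sub>0,t)"] by simp
    moreover have "dist s t < e" using z zeq dist_snd_le[of z "(w\<^sub>0,t)"] by simp
    ultimately have "f w\<^sub>0 - e < f w" "f w < t + e"
      using d[of w] unfolding dist_real_def by linarith+
    then show False unfolding e_def by argo
  qed
  have "convex ?S" using assms by (simp add: convex_epigraph convex_closure)
  then obtain n b where below: "n \<bullet> (w\<^sub>0, t) < b" and above: "\<And>z. z \<in> ?S \<Longrightarrow> b < n \<bullet> z"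
    using separating_hyperplane_closed_point[OF _ closed_closure notin] by blast
  obtain \<alpha> \<beta> where n: "n = (\<alpha>, \<beta>)" by (cases n)
  have low: "\<alpha> \<bullet> w\<^sub>0 + \<beta> * t < b" using below n by simp
  have up: "b < \<alpha> \<bullet> w + \<beta> * f w" if "w \<in> K" for w
  proof -
    have "(w, f w) \<in> ?S" using that by (intro closure_subset[THEN subsetD]) (simp add: mem_epigraph)
    then show ?thesis using above n by fastforce
  qed
  \<comment> \<open>The hyperplane is not vertical, so it can be solved for the last coordinate.\<close>
  have "\<beta> * t < \<beta> * f w\<^sub>0" using low up[OF \<open>w\<^sub>0 \<in> K\<close>] by linarith
  then have "\<beta> > 0" using \<open>t < f w\<^sub>0\<close> by (simp add: mult_less_cancel_left)
  show thesis
  proof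
    show "(- \<alpha> /\<^sub>R \<beta>) \<bullet> w + b / \<beta> \<le> f w" if "w \<in> K" for w
      using up[OF that] \<open>\<beta> > 0\<close> by (simp add: field_simps)
    show "t < (- \<alpha> /\<^sub>R \<beta>) \<bullet> w\<^sub>0 + b / \<beta>"
      using low \<open>\<beta> > 0\<close> by (simp add: field_simps)
  qed
qed

text \<open>The open subgraphs of the affine minorants cover the part of the strict subgraph of \<open>f\<close> that lies
  over \<open>K\<close>. The product space is Lindelof, so countably many of them have the same union, and
  countably many minorants have the same supremum. The truncation of negative values by \<open>ennreal\<close> is
  harmless because \<open>f\<close> is nonnegative.\<close>

lemma convex_eq_SUP_affine:
  fixes f :: "'a::euclidean_space \<Rightarrow> real"
  assumes "convex_on K f" "continuous_on K f" "\<And>w. w \<in> K \<Longrightarrow> 0 \<le> f w"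
  obtains a :: "nat \<Rightarrow> 'a" and c :: "nat \<Rightarrow> real"
    where "\<And>k w. w \<in> K \<Longrightarrow> a k \<bullet> w + c k \<le> f w"
      "\<And>w. w \<in> K \<Longrightarrow> ennreal (f w) = (SUP k. ennreal (a k \<bullet> w + c k))"
proof -
  define L where "L = {(a, c). \<forall>w\<in>K. a \<bullet> w + c \<le> f w}"
  define H where "H = (\<lambda>(a::'a, c). {(w, t). t < a \<bullet> w + c})"
  have "open (H l)" for l
  proof -
    obtain a c where "l = (a, c)" by (cases l)
    then have "H l = {z. snd z < a \<bullet> fst z + c}" by (auto simp: H_def)
    then show ?thesis by (auto intro!: open_Collect_less continuous_intros)
  qed
  then obtain F where F: "F \<subseteq> H ` L" "countable F" "\<Union>F = \<Union>(H ` L)"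
    by (metis (no_types, lifting) Lindelof[of "H ` L"] imageE)
  then obtain L\<^sub>0 where L0: "L\<^sub>0 \<subseteq> L" "countable L\<^sub>0" "\<Union>(H ` L\<^sub>0) = \<Union>(H ` L)"
    using countable_subset_image[of F H L] by auto
  \<comment> \<open>Adding the zero minorant makes the family nonempty, so that a sequence can enumerate it.\<close>
  have "(0, 0) \<in> L" using assms by (auto simp: L_def)
  then have "countable (insert (0, 0) L\<^sub>0)" "insert (0, 0) L\<^sub>0 \<subseteq> L" using L0 by auto
  then obtain l :: "nat \<Rightarrow> 'a \<times> real" where l: "range l = insert (0, 0) L\<^sub>0"
    using range_from_nat_into[of "insert (0, 0) L\<^sub>0"] by blast
  have minor: "fst (l k) \<bullet> w + snd (l k) \<le> f w" if "w \<in> K" for k w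
  proof -
    have "l k \<in> L" using l \<open>insert (0, 0) L\<^sub>0 \<subseteq> L\<close> rangeI[of l k] by (metis subsetD)
    then show ?thesis using that by (auto simp: L_def)
  qed
  have "ennreal (f w) = (SUP k. ennreal (fst (l k) \<bullet> w + snd (l k)))" if "w \<in> K" for w
  proof (rule antisym)
    show "(SUP k. ennreal (fst (l k) \<bullet> w + snd (l k))) \<le> ennreal (f w)"
      using minor[OF that] by (intro SUP_least ennreal_leI)
    show "ennreal (f w) \<le> (SUP k. ennreal (fst (l k) \<bullet> w + snd (l k)))"
    proof (rule dense_le)
      fix y assume y: "y < ennreal (f w)"
      then obtain t where t: "y = ennreal t" "0 \<le> t" by (cases y) auto
      then have "t < f w" using y by (simp add: ennreal_less_iff)
      obtain a c where ac: "\<And>v. v \<in> K \<Longrightarrow> a \<bullet> v + c \<le> f v" "t < a \<bullet> w + c"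
        using affine_minorant_exceeding[OF assms(1,2) \<open>w \<in> K\<close> \<open>t < f w\<close>] by blast
      then have "(a, c) \<in> L" "(w, t) \<in> H (a, c)" by (auto simp: L_def H_def)
      then obtain q where "q \<in> L\<^sub>0" "(w, t) \<in> H q" using L0 by blast
      then obtain k where "l k = q" using l by (metis insertCI rangeE)
      then have "t < fst (l k) \<bullet> w + snd (l k)" using \<open>(w, t) \<in> H q\<close> by (auto simp: H_def split: prod.splits)
      then have "y \<le> ennreal (fst (l k) \<bullet> w + snd (l k))" using t by (simp add: ennreal_leI)
      then show "y \<le> (SUP k. ennreal (fst (l k) \<bullet> w + snd (l k)))"
        by (meson SUP_upper2 UNIV_I)
    qed
  qed
  with minor show thesis by (intro that[of "\<lambda>k. fst (l k)" "\<lambda>k. snd (l k)"])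
qed

section \<open>Superadditive bounds for integrals\<close>

text \<open>The hypothesis on all measurable \<open>E\<close>, rather than on one, is what makes the induction over running
  maxima work: on each piece of \<open>E\<close> a running maximum coincides with a function already bounded by
  \<open>\<Phi>\<close>, and superadditivity reassembles the pieces.\<close>

lemma nn_integral_SUP_le_superadditive:
  fixes h :: "nat \<Rightarrow> 'a \<Rightarrow> ennreal" and \<Phi> :: "'a set \<Rightarrow> ennreal"
  assumes [measurable]: "\<And>k. h k \<in> borel_measurable M"
    and super: "\<And>A B. A \<in> sets M \<Longrightarrow> B \<in> sets M \<Longrightarrow> A \<inter> B = {} \<Longrightarrow> \<Phi> A + \<Phi> B \<le> \<Phi> (A \<union> B)"
    and le: "\<And>k E. E \<in> sets M \<Longrightarrow> (\<integral>\<^sup>+x\<in>E. h k x \<partial>M) \<le> \<Phi> E"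
    and E: "E \<in> sets M"
  shows "(\<integral>\<^sup>+x\<in>E. (SUP k. h k x) \<partial>M) \<le> \<Phi> E"
proof -
  define g where "g n x = (SUP k\<in>{..n}. h k x)" for n :: nat and x
  have [measurable]: "g n \<in> borel_measurable M" for n
    unfolding g_def by measurable
  have g_Suc: "g (Suc n) x = sup (h (Suc n) x) (g n x)" for n x
    by (simp add: g_def atMost_Suc)
  have g_le: "(\<integral>\<^sup>+x\<in>A. g n x \<partial>M) \<le> \<Phi> A" if "A \<in> sets M" for n A
    using that
  proof (induction n arbitrary: A)
    case 0
    then show ?case using le[of A 0] by (simp add: g_def)
  next
    case (Suc n)
    note [measurable] = Suc.prems
    define B where "B = {x \<in> space M. g n x < h (Suc n) x}"
    have [measurable]: "B \<in> sets M" by (simp add: B_def)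
    have "(\<integral>\<^sup>+x\<in>A. g (Suc n) x \<partial>M)
        = (\<integral>\<^sup>+x\<in>A \<inter> B. g (Suc n) x \<partial>M) + (\<integral>\<^sup>+x\<in>A - B. g (Suc n) x \<partial>M)"
      by (subst nn_integral_disjoint_pair[symmetric]) (auto simp: Int_Diff_Un)
    also have "(\<integral>\<^sup>+x\<in>A \<inter> B. g (Suc n) x \<partial>M) = (\<integral>\<^sup>+x\<in>A \<inter> B. h (Suc n) x \<partial>M)"
      by (rule nn_integral_cong) (auto simp: g_Suc B_def sup_max max_def split: split_indicator)
    also have "(\<integral>\<^sup>+x\<in>A - B. g (Suc n) x \<partial>M) = (\<integral>\<^sup>+x\<in>A - B. g n x \<partial>M)"
      by (rule nn_integral_cong) (auto simp: g_Suc B_def sup_max max_def split: split_indicator)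
    also have "(\<integral>\<^sup>+x\<in>A \<inter> B. h (Suc n) x \<partial>M) + \<dots> \<le> \<Phi> (A \<inter> B) + \<Phi> (A - B)"
      by (intro add_mono le Suc.IH) auto
    also have "\<dots> \<le> \<Phi> ((A \<inter> B) \<union> (A - B))" by (rule super) auto
    finally show ?case by (simp add: Int_Diff_Un)
  qed
  have SUP_g: "(SUP k. h k x) = (SUP n. g n x)" for x
    unfolding g_def by (intro antisym SUP_least SUP_mono) (auto intro: SUP_upper)
  have "(\<integral>\<^sup>+x\<in>E. (SUP k. h k x) \<partial>M) = (\<integral>\<^sup>+x. (SUP n. g n x * indicator E x) \<partial>M)"
    by (simp add: SUP_g SUP_mult_right_ennreal)
  also have "\<dots> = (SUP n. \<integral>\<^sup>+x\<in>E. g n x \<partial>M)"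
    using E by (intro nn_integral_monotone_convergence_SUP)
      (auto simp: incseq_Suc_iff le_fun_def g_Suc intro!: mult_right_mono)
  also have "\<dots> \<le> \<Phi> E" using g_le[OF E] by (intro SUP_least)
  finally show ?thesis .
qed

lemma liminf_add_le_ennreal:
  fixes x y :: "nat \<Rightarrow> ennreal"
  shows "liminf x + liminf y \<le> liminf (\<lambda>i. x i + y i)"
proof -
  have inc: "incseq (\<lambda>n. INF m\<in>{n..}. z m)" for z :: "nat \<Rightarrow> ennreal"
    by (intro incseq_SucI INF_superset_mono) auto
  have "liminf x + liminf y = (SUP n. (INF m\<in>{n..}. x m) + (INF m\<in>{n..}. y m))"
    unfolding liminf_SUP_INF by (rule ennreal_SUP_add[OF inc inc, symmetric])
  also have "\<dots> \<le> (SUP n. INF m\<in>{n..}. x m + y m)"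
    by (intro SUP_mono') (auto intro!: INF_greatest add_mono INF_lower)
  finally show ?thesis by (simp add: liminf_SUP_INF)
qed

lemma liminf_nn_integral_superadditive:
  fixes F :: "nat \<Rightarrow> 'a \<Rightarrow> ennreal"
  assumes "\<And>i. F i \<in> borel_measurable M" "A \<in> sets M" "B \<in> sets M" "A \<inter> B = {}"
  shows "liminf (\<lambda>i. \<integral>\<^sup>+x\<in>A. F i x \<partial>M) + liminf (\<lambda>i. \<integral>\<^sup>+x\<in>B. F i x \<partial>M)
    \<le> liminf (\<lambda>i. \<integral>\<^sup>+x\<in>A \<union> B. F i x \<partial>M)"
  using liminf_add_le_ennreal[of "\<lambda>i. \<integral>\<^sup>+x\<in>A. F i x \<partial>M" "\<lambda>i. \<integral>\<^sup>+x\<in>B. F i x \<partial>M"]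
  by (simp add: nn_integral_disjoint_pair assms)

section \<open>Weak convergence tested on affine functions\<close>

text \<open>On a set of finite measure \<open>\<bar>g\<bar> \<le> 1 + \<bar>g\<bar> powr p\<close> gives an integrable bound.\<close>

lemma Lp_space_integrable_on:
  assumes "1 \<le> p" "g \<in> Lp_space p M" "E \<in> sets M" "emeasure M E < \<infinity>"
  shows "integrable M (\<lambda>x. g x * indicator E x)"
proof -
  have [measurable]: "g \<in> borel_measurable M" "E \<in> sets M"
    and fin: "(\<integral>\<^sup>+x. ennreal (\<bar>g x\<bar> powr p) \<partial>M) < \<infinity>"
    using assms by (auto simp: Lp_space_def)
  have bound: "\<bar>t\<bar> \<le> 1 + \<bar>t\<bar> powr p" for t :: real
  proof (cases "\<bar>t\<bar> \<le> 1")
    case False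
    then show ?thesis using powr_mono[of 1 p "\<bar>t\<bar>"] \<open>1 \<le> p\<close> by simp
  qed (simp add: add_increasing2)
  have "(\<integral>\<^sup>+x. ennreal (norm (g x * indicator E x)) \<partial>M)
      \<le> (\<integral>\<^sup>+x. indicator E x + ennreal (\<bar>g x\<bar> powr p) \<partial>M)"
  proof (rule nn_integral_mono)
    fix x
    show "ennreal (norm (g x * indicator E x)) \<le> indicator E x + ennreal (\<bar>g x\<bar> powr p)"
      using bound[of "g x"] by (auto split: split_indicator simp flip: ennreal_1 ennreal_plus intro!: ennreal_leI)
  qed
  also have "\<dots> = emeasure M E + (\<integral>\<^sup>+x. ennreal (\<bar>g x\<bar> powr p) \<partial>M)"
    by (simp add: nn_integral_add)
  also have "\<dots> < \<infinity>" using fin assms by simp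
  finally show ?thesis by (intro integrableI_bounded) auto
qed

lemma indicator_in_Lp_dual_space:
  assumes "E \<in> sets M" "emeasure M E < \<infinity>"
  shows "indicator E \<in> Lp_dual_space p M"
proof -
  have "(\<integral>\<^sup>+x. ennreal (\<bar>indicator E x\<bar> powr r) \<partial>M) = (\<integral>\<^sup>+x. indicator E x \<partial>M)" for r :: real
    by (intro nn_integral_cong) (auto split: split_indicator)
  then show ?thesis
    using assms by (auto simp: Lp_dual_space_def Lp_space_def Linf_space_def
      intro!: exI[of _ 1] AE_I2 split: split_indicator)
qed

lemma has_bochner_integral_affine_on:
  fixes g :: "'a \<Rightarrow> real ^ 'm"
  assumes "1 \<le> p" "\<And>j. (\<lambda>x. g x $ j) \<in> Lp_space p M" "E \<in> sets M" "emeasure M E < \<infinity>"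
  shows "has_bochner_integral M (\<lambda>x. indicator E x *\<^sub>R (a \<bullet> g x + c))
    ((\<Sum>j\<in>UNIV. a $ j * (\<integral>x. g x $ j * indicator E x \<partial>M)) + c * measure M E)"
proof -
  have "has_bochner_integral M (\<lambda>x. (\<Sum>j\<in>UNIV. a $ j * (g x $ j * indicator E x)) + c * indicator E x)
    ((\<Sum>j\<in>UNIV. a $ j * (\<integral>x. g x $ j * indicator E x \<partial>M)) + c * measure M E)"
    using Lp_space_integrable_on[OF assms(1,2,3,4)] assms
    by (intro has_bochner_integral_add has_bochner_integral_sum has_bochner_integral_mult_right
        has_bochner_integral_integrable has_bochner_integral_real_indicator) auto
  moreover have "(\<Sum>j\<in>UNIV. a $ j * (g x $ j * indicator E x)) + c * indicator E x
      = indicator E x *\<^sub>R (a \<bullet> g x + c)" for x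
    by (simp add: inner_vec_def split: split_indicator)
  ultimately show ?thesis by simp
qed

lemma weakly_converges_affine:
  fixes us :: "nat \<Rightarrow> 'a \<Rightarrow> real ^ 'm"
  assumes "1 \<le> p" "weakly_converges_Lp_vec p M us u" "E \<in> sets M" "emeasure M E < \<infinity>"
  shows "set_integrable M E (\<lambda>x. a \<bullet> us i x + c)"
    and "set_integrable M E (\<lambda>x. a \<bullet> u x + c)"
    and "(\<lambda>i. \<integral>x\<in>E. (a \<bullet> us i x + c) \<partial>M) \<longlonglongrightarrow> (\<integral>x\<in>E. (a \<bullet> u x + c) \<partial>M)"
proof -
  have Lp: "(\<lambda>x. us i x $ j) \<in> Lp_space p M" "(\<lambda>x. u x $ j) \<in> Lp_space p M" for i j
    using assms(2) by (auto simp: weakly_converges_Lp_vec_def weakly_converges_Lp_def)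
  have lim: "(\<lambda>i. \<integral>x. us i x $ j * indicator E x \<partial>M) \<longlonglongrightarrow> (\<integral>x. u x $ j * indicator E x \<partial>M)" for j
    using assms(2) indicator_in_Lp_dual_space[OF assms(3,4), of p]
    by (auto simp: weakly_converges_Lp_vec_def weakly_converges_Lp_def)
  note int = has_bochner_integral_affine_on[OF assms(1) _ assms(3,4)]
  show "set_integrable M E (\<lambda>x. a \<bullet> us i x + c)" "set_integrable M E (\<lambda>x. a \<bullet> u x + c)"
    unfolding set_integrable_def by (rule integrable.intros[OF int], rule Lp)+
  show "(\<lambda>i. \<integral>x\<in>E. (a \<bullet> us i x + c) \<partial>M) \<longlonglongrightarrow> (\<integral>x\<in>E. (a \<bullet> u x + c) \<partial>M)"
    unfolding set_lebesgue_integral_def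
      has_bochner_integral_integral_eq[OF int[OF Lp(1)]] has_bochner_integral_integral_eq[OF int[OF Lp(2)]]
    by (intro tendsto_intros lim)
qed

lemma weakly_converges_borel_measurable:
  fixes us :: "nat \<Rightarrow> 'a \<Rightarrow> real ^ 'm"
  assumes "weakly_converges_Lp_vec p M us u"
  shows "us i \<in> borel_measurable M" "u \<in> borel_measurable M"
proof -
  have vec: "g \<in> borel_measurable M" if g: "\<And>j. (\<lambda>x. g x $ j) \<in> borel_measurable M"
    for g :: "'a \<Rightarrow> real ^ 'm"
  proof (rule borel_measurable_euclidean_space[THEN iffD2], rule ballI)
    fix b :: "real ^ 'm"
    assume "b \<in> Basis"
    then obtain j where "b = axis j 1" by (auto simp: Basis_vec_def)
    then show "(\<lambda>x. g x \<bullet> b) \<in> borel_measurable M" using g[of j] by (simp add: inner_axis)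
  qed
  show "us i \<in> borel_measurable M" "u \<in> borel_measurable M"
    using assms by (intro vec; simp add: weakly_converges_Lp_vec_def weakly_converges_Lp_def Lp_space_def)+
qed

text \<open>Weak convergence concerns signed integrals, whereas \<open>ennreal\<close> discards negative values. Testing
  with the set \<open>P\<close> where the limit is positive reconciles the two: there the positive part of the
  limit is the affine function itself, and along the sequence the integral only grows when its
  integrand is truncated at zero, and after truncation it is at most \<open>ennreal (F i x)\<close>.\<close>

lemma nn_integral_affine_le_liminf_finite:
  fixes us :: "nat \<Rightarrow> 'a \<Rightarrow> real ^ 'm"
  assumes "1 \<le> p" and weak: "weakly_converges_Lp_vec p M us u"
    and minor: "\<And>i x. a \<bullet> us i x + c \<le> F i x"
    and E: "E \<in> sets M" "emeasure M E < \<infinity>"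
  shows "(\<integral>\<^sup>+x\<in>E. ennreal (a \<bullet> u x + c) \<partial>M) \<le> liminf (\<lambda>i. \<integral>\<^sup>+x\<in>E. ennreal (F i x) \<partial>M)"
proof -
  note [measurable] = weakly_converges_borel_measurable[OF weak] E(1)
  define P where "P = {x \<in> E. 0 < a \<bullet> u x + c}"
  have "P = E \<inter> {x \<in> space M. 0 < a \<bullet> u x + c}"
    using sets.sets_into_space[OF E(1)] by (auto simp: P_def)
  then have P[measurable]: "P \<in> sets M" by simp
  have "emeasure M P \<le> emeasure M E" by (rule emeasure_mono) (auto simp: P_def)
  then have P_fin: "emeasure M P < \<infinity>" using E(2) by simp
  note wc = weakly_converges_affine[OF \<open>1 \<le> p\<close> weak P P_fin, where a = a and c = c]
  have pos: "(\<integral>\<^sup>+x\<in>E. ennreal (a \<bullet> u x + c) \<partial>M) = ennreal (\<integral>x\<in>P. (a \<bullet> u x + c) \<partial>M)"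
  proof -
    have "(\<integral>\<^sup>+x\<in>E. ennreal (a \<bullet> u x + c) \<partial>M)
        = (\<integral>\<^sup>+x. ennreal (indicator P x *\<^sub>R (a \<bullet> u x + c)) \<partial>M)"
      by (rule nn_integral_cong) (auto simp: P_def ennreal_neg split: split_indicator)
    also have "\<dots> = ennreal (\<integral>x\<in>P. (a \<bullet> u x + c) \<partial>M)"
      using wc(2) unfolding set_lebesgue_integral_def set_integrable_def
      by (intro nn_integral_eq_integral) (auto simp: P_def split: split_indicator)
    finally show ?thesis .
  qed
  have le: "ennreal (\<integral>x\<in>P. (a \<bullet> us i x + c) \<partial>M) \<le> (\<integral>\<^sup>+x\<in>E. ennreal (F i x) \<partial>M)" for i
  proof -
    have "ennreal (\<integral>x\<in>P. (a \<bullet> us i x + c) \<partial>M)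
        \<le> ennreal (\<integral>x. max 0 (indicator P x *\<^sub>R (a \<bullet> us i x + c)) \<partial>M)"
      using wc(1)[of i] unfolding set_lebesgue_integral_def set_integrable_def
      by (intro ennreal_leI integral_mono integrable_max) auto
    also have "\<dots> = (\<integral>\<^sup>+x. ennreal (max 0 (indicator P x *\<^sub>R (a \<bullet> us i x + c))) \<partial>M)"
      using wc(1)[of i] unfolding set_integrable_def
      by (intro nn_integral_eq_integral[symmetric] integrable_max) auto
    also have "\<dots> \<le> (\<integral>\<^sup>+x\<in>E. ennreal (F i x) \<partial>M)"
    proof (rule nn_integral_mono)
      fix x
      have "ennreal (max 0 t) = ennreal t" for t by (simp add: max_def ennreal_neg)
      then show "ennreal (max 0 (indicator P x *\<^sub>R (a \<bullet> us i x + c))) \<le> ennreal (F i x) * indicator E x"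
        using ennreal_leI[OF minor[of i x]] by (simp add: P_def split: split_indicator)
    qed
    finally show ?thesis .
  qed
  have "(\<lambda>i. ennreal (\<integral>x\<in>P. (a \<bullet> us i x + c) \<partial>M)) \<longlonglongrightarrow> ennreal (\<integral>x\<in>P. (a \<bullet> u x + c) \<partial>M)"
    by (intro tendsto_ennrealI wc)
  then have "ennreal (\<integral>x\<in>P. (a \<bullet> u x + c) \<partial>M) = liminf (\<lambda>i. ennreal (\<integral>x\<in>P. (a \<bullet> us i x + c) \<partial>M))"
    by (intro lim_imp_Liminf[symmetric]) auto
  also have "\<dots> \<le> liminf (\<lambda>i. \<integral>\<^sup>+x\<in>E. ennreal (F i x) \<partial>M)"
    by (intro Liminf_mono always_eventually allI le)
  finally show ?thesis unfolding pos .
qed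

text \<open>Constants are not integrable on sets of infinite measure, so the affine function is written as the
  supremum of its restrictions to sets of finite measure.\<close>

lemma nn_integral_affine_le_liminf:
  fixes us :: "nat \<Rightarrow> 'a \<Rightarrow> real ^ 'm"
  assumes "sigma_finite_measure M" "1 \<le> p" and weak: "weakly_converges_Lp_vec p M us u"
    and minor: "\<And>i x. a \<bullet> us i x + c \<le> F i x"
    and F[measurable]: "\<And>i. F i \<in> borel_measurable M" and E: "E \<in> sets M"
  shows "(\<integral>\<^sup>+x\<in>E. ennreal (a \<bullet> u x + c) \<partial>M) \<le> liminf (\<lambda>i. \<integral>\<^sup>+x\<in>E. ennreal (F i x) \<partial>M)"
proof -
  note [measurable] = weakly_converges_borel_measurable[OF weak]
  obtain A :: "nat \<Rightarrow> 'a set" where "range A \<subseteq> sets M" and cover: "(\<Union>j. A j) = space M"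
      and fin: "\<And>j. emeasure M (A j) \<noteq> \<infinity>"
    using sigma_finite_measure.sigma_finite[OF assms(1)] by blast
  then have [measurable]: "A j \<in> sets M" for j by blast
  define h where "h j x = ennreal (a \<bullet> u x + c) * indicator (A j) x" for j x
  have SUP_h: "(SUP j. h j x) = ennreal (a \<bullet> u x + c)" if "x \<in> space M" for x
  proof (rule antisym)
    show "(SUP j. h j x) \<le> ennreal (a \<bullet> u x + c)"
      by (rule SUP_least) (simp add: h_def split: split_indicator)
    have "x \<in> (\<Union>j. A j)" using that cover by simp
    then obtain j where "x \<in> A j" by (rule UN_E)
    then show "ennreal (a \<bullet> u x + c) \<le> (SUP j. h j x)"
      by (intro SUP_upper2[where i = j]) (simp_all add: h_def)
  qed
  have h_le: "(\<integral>\<^sup>+x\<in>B. h j x \<partial>M) \<le> liminf (\<lambda>i. \<integral>\<^sup>+x\<in>B. ennreal (F i x) \<partial>M)"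
    if [measurable]: "B \<in> sets M" for B j
  proof -
    have "emeasure M (B \<inter> A j) \<le> emeasure M (A j)" by (rule emeasure_mono) auto
    then have "emeasure M (B \<inter> A j) < \<infinity>" using fin[of j] by (simp add: less_top order_le_less_trans)
    moreover have "(\<integral>\<^sup>+x\<in>B. h j x \<partial>M) = (\<integral>\<^sup>+x\<in>B \<inter> A j. ennreal (a \<bullet> u x + c) \<partial>M)"
      by (rule nn_integral_cong) (simp add: h_def split: split_indicator)
    ultimately have "(\<integral>\<^sup>+x\<in>B. h j x \<partial>M) \<le> liminf (\<lambda>i. \<integral>\<^sup>+x\<in>B \<inter> A j. ennreal (F i x) \<partial>M)"
      using nn_integral_affine_le_liminf_finite[OF \<open>1 \<le> p\<close> weak minor, of "B \<inter> A j"] by simp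
    also have "\<dots> \<le> liminf (\<lambda>i. \<integral>\<^sup>+x\<in>B. ennreal (F i x) \<partial>M)"
      by (intro Liminf_mono always_eventually allI nn_set_integral_set_mono) auto
    finally show ?thesis .
  qed
  have "(\<integral>\<^sup>+x\<in>E. ennreal (a \<bullet> u x + c) \<partial>M) = (\<integral>\<^sup>+x\<in>E. (SUP j. h j x) \<partial>M)"
    by (rule nn_integral_cong) (simp add: SUP_h)
  also have "\<dots> \<le> liminf (\<lambda>i. \<integral>\<^sup>+x\<in>E. ennreal (F i x) \<partial>M)"
  proof (rule nn_integral_SUP_le_superadditive[OF _ _ h_le E])
    show "h j \<in> borel_measurable M" for j unfolding h_def by measurable
  qed (auto intro!: liminf_nn_integral_superadditive)
  finally show ?thesis .
qed

section \<open>Lower semicontinuity of convex integrals\<close>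

text \<open>The set \<open>K\<close> need not be Borel (a convex set may contain an arbitrary part of its boundary), so \<open>f\<close>
  is regarded as measurable on the trace of the Borel sets on \<open>K\<close>.\<close>

lemma borel_measurable_continuous_on_compose:
  assumes "continuous_on K f" "g \<in> borel_measurable M" "\<And>x. g x \<in> K"
  shows "(\<lambda>x. f (g x)) \<in> borel_measurable M"
proof -
  have "g \<in> measurable M (restrict_space borel K)"
    using assms by (intro measurable_restrict_space2) auto
  then show ?thesis
    using measurable_compose[OF _ borel_measurable_continuous_on_restrict[OF assms(1)]] by blast
qed

theorem weak_lower_semicontinuity_convex_integral:
  fixes us :: "nat \<Rightarrow> 'a \<Rightarrow> real ^ 'm"
  assumes "sigma_finite_measure M" "1 \<le> p" and weak: "weakly_converges_Lp_vec p M us u"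
    and us: "\<And>i x. us i x \<in> K" and u: "\<And>x. u x \<in> K"
    and f: "convex_on K f" "continuous_on K f" "\<And>w. w \<in> K \<Longrightarrow> 0 \<le> f w"
    and E: "E \<in> sets M"
  shows "(\<integral>\<^sup>+x\<in>E. ennreal (f (u x)) \<partial>M) \<le> liminf (\<lambda>i. \<integral>\<^sup>+x\<in>E. ennreal (f (us i x)) \<partial>M)"
proof -
  note meas = weakly_converges_borel_measurable[OF weak]
  note [measurable] = meas borel_measurable_continuous_on_compose[OF f(2) meas(1) us]
  obtain a c where minor: "\<And>k w. w \<in> K \<Longrightarrow> a k \<bullet> w + c k \<le> f w"
      and SUP: "\<And>w. w \<in> K \<Longrightarrow> ennreal (f w) = (SUP k::nat. ennreal (a k \<bullet> w + c k))"
    by (rule convex_eq_SUP_affine[OF f]) (assumption, rule that, blast+)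
  have affine_le: "(\<integral>\<^sup>+x\<in>B. ennreal (a k \<bullet> u x + c k) \<partial>M) \<le> liminf (\<lambda>i. \<integral>\<^sup>+x\<in>B. ennreal (f (us i x)) \<partial>M)"
    if "B \<in> sets M" for B k
    using that by (intro nn_integral_affine_le_liminf[OF assms(1,2) weak] minor us) measurable
  have "(\<integral>\<^sup>+x\<in>E. (SUP k. ennreal (a k \<bullet> u x + c k)) \<partial>M) \<le> liminf (\<lambda>i. \<integral>\<^sup>+x\<in>E. ennreal (f (us i x)) \<partial>M)"
    by (rule nn_integral_SUP_le_superadditive[OF _ _ affine_le E])
      (auto intro!: liminf_nn_integral_superadditive)
  then show ?thesis by (simp add: SUP[OF u])
qed

lemma sigma_finite_lebesgue: "sigma_finite_measure (lebesgue :: 'a::euclidean_space measure)"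
proof
  obtain A where "countable A" "A \<subseteq> sets lborel" "\<Union>A = space (lborel :: 'a measure)"
      "\<forall>a\<in>A. emeasure lborel a \<noteq> \<infinity>"
    using lborel.sigma_finite_countable by blast
  then show "\<exists>A::'a set set. countable A \<and> A \<subseteq> sets lebesgue \<and> \<Union>A = space lebesgue \<and>
      (\<forall>a\<in>A. emeasure lebesgue a \<noteq> \<infinity>)"
    by (intro exI[of _ A]) auto
qed

theorem theorem3:
  fixes p :: real
    and us :: "nat \<Rightarrow> real ^ 'n \<Rightarrow> real ^ 'm"
    and u :: "real ^ 'n \<Rightarrow> real ^ 'm"
    and K :: "(real ^ 'm) set"
    and f :: "real ^ 'm \<Rightarrow> real"
    and \<Omega> :: "(real ^ 'n) set"
  assumes "1 \<le> p"
    and "weakly_converges_Lp_vec p lebesgue us u"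
    and "convex K"
    and "\<And>i x. us i x \<in> K"
    and "\<And>x. u x \<in> K"
    and "\<And>w. w \<in> K \<Longrightarrow> 0 \<le> f w"
    and "continuous_on K f"
    and "convex_on K f"
    and "\<Omega> \<in> sets lebesgue"
  shows "liminf (\<lambda>i. \<integral>\<^sup>+x\<in>\<Omega>. ennreal (f (us i x)) \<partial>lebesgue)
           \<ge> (\<integral>\<^sup>+x\<in>\<Omega>. ennreal (f (u x)) \<partial>lebesgue)"
  using assms by (intro weak_lower_semicontinuity_convex_integral[OF sigma_finite_lebesgue]) auto

end
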